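(* There is a constant $c>0$ such that the following holds. Any distributed protocol in the CONGEST model with success probability at least $2/3$ which, given a graph with $n$ nodes and a set of $p\le c n^{3/2}$ pairs of nodes, outputs a $(+2)$-pairwise spanner with at most $c n^{3/2}$ edges, must take $\Omega\!\left(\frac{p}{n\log n}\right)$ rounds to complete (in the worst case over inputs). This lower bound holds even when restricted to input graphs of constant diameter.
   Context: Graphs are undirected and unweighted; $\delta_H(u,v)$ denotes the distance between $u$ and $v$ in $H$. Given a graph $G=(V,E)$ and a set $\mathcal{P}\subseteq V\times V$ of pairs, a subgraph $H$ of $G$ (on the same node set) is a $(+2)$-pairwise spanner for $\mathcal{P}$ if $\delta_H(u,v)\le\delta_G(u,v)+2$ for all $(u,v)\in\mathcal{P}$. CONGEST model: the nodes of the input graph are processors with unique $O(\log n)$-bit identifiers; computation proceeds in synchronous rounds, in each of which every node may send an $O(\log n)$-bit message to each of its neighbors, followed by unbounded local computation. Initially each node knows its identifier, its neighbors' identifiers, and the pairs of $\mathcal{P}$ it belongs to; at the end each node must know which of its incident edges belong to the output subgraph. *)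

theory Defs
  imports "HOL-Probability.Probability" "HOL-Probability.Product_PMF" "HOL-Library.Extended_Nat"
begin

section \<open>Graphs and pairwise spanners\<close>

text \<open>
  Nodes are identified with their (unique) identifiers, which are natural numbers.
  Undirected edges are two-element sets of nodes, so a graph is given by a node set
  \<open>V\<close> and an edge set \<open>E\<close>.
\<close>

definition simple_graph :: "nat set \<Rightarrow> nat set set \<Rightarrow> bool" where
  "simple_graph V E \<longleftrightarrow> finite V \<and> (\<forall>e\<in>E. e \<subseteq> V \<and> card e = 2)"

definition neighbors :: "nat set set \<Rightarrow> nat \<Rightarrow> nat set" where
  "neighbors E v = {u. {u, v} \<in> E}"

text \<open>A walk is its nonempty list of nodes; its length is the number of edges traversed.\<close>

definition walks :: "nat set set \<Rightarrow> nat \<Rightarrow> nat \<Rightarrow> nat list set" where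
  "walks E u v =
     {xs. xs \<noteq> [] \<and> hd xs = u \<and> last xs = v \<and> successively (\<lambda>x y. {x, y} \<in> E) xs}"

text \<open>The distance is \<open>\<infinity>\<close> (the infimum of the empty set) for disconnected nodes.\<close>

definition graph_dist :: "nat set set \<Rightarrow> nat \<Rightarrow> nat \<Rightarrow> enat" where
  "graph_dist E u v = (INF xs\<in>walks E u v. enat (length xs - 1))"

definition diameter_le :: "nat set \<Rightarrow> nat set set \<Rightarrow> nat \<Rightarrow> bool" where
  "diameter_le V E D \<longleftrightarrow> (\<forall>u\<in>V. \<forall>v\<in>V. graph_dist E u v \<le> enat D)"

definition plus2_pairwise_spanner ::
    "nat set set \<Rightarrow> (nat \<times> nat) set \<Rightarrow> nat set set \<Rightarrow> bool" where
  "plus2_pairwise_spanner E P H \<longleftrightarrow>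
     H \<subseteq> E \<and> (\<forall>(u, v)\<in>P. graph_dist H u v \<le> graph_dist E u v + 2)"


section \<open>Randomized protocols in the CONGEST model\<close>

text \<open>
  Local computation and memory are unbounded, so the local state of a node is taken to be
  everything the node has seen so far: its initial knowledge and the list (most recent
  event first) of its private random choices and of the messages it received.  A received
  message is indexed by the identifier of its sender.
\<close>

datatype event = Coin nat | Received "nat \<Rightarrow> bool list"

record view =
  self :: nat
  nbrs :: "nat set"
  own_pairs :: "(nat \<times> nat) set"
  history :: "event list"

definition observe :: "event \<Rightarrow> view \<Rightarrow> view" where
  "observe x s = s\<lparr>history := x # history s\<rparr>"

text \<open>
  A protocol prescribes the distribution of a node's next private random choice (any
  discrete distribution, encoded on the natural numbers), the message it sends to the
  neighbor with a given identifier, and its output: the set of those neighbors to which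
  it is joined by an edge of the output subgraph.
\<close>

record protocol =
  coin :: "view \<Rightarrow> nat pmf"
  message :: "view \<Rightarrow> nat \<Rightarrow> bool list"
  result :: "view \<Rightarrow> nat set"

definition bandwidth_le :: "protocol \<Rightarrow> real \<Rightarrow> bool" where
  "bandwidth_le A b \<longleftrightarrow> (\<forall>s u. real (length (message A s u)) \<le> b)"

definition initial_view :: "nat set set \<Rightarrow> (nat \<times> nat) set \<Rightarrow> nat \<Rightarrow> view" where
  "initial_view E P v =
     \<lparr>self = v, nbrs = neighbors E v, own_pairs = {(x, y)\<in>P. x = v \<or> y = v}, history = []\<rparr>"

text \<open>The nodes toss their private coins independently of each other.\<close>

definition toss :: "protocol \<Rightarrow> nat set \<Rightarrow> (nat \<Rightarrow> view) \<Rightarrow> (nat \<Rightarrow> view) pmf" where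
  "toss A V \<sigma> =
     Pi_pmf V undefined (\<lambda>v. map_pmf (\<lambda>r. observe (Coin r) (\<sigma> v)) (coin A (\<sigma> v)))"

definition exchange :: "protocol \<Rightarrow> nat set set \<Rightarrow> (nat \<Rightarrow> view) \<Rightarrow> nat \<Rightarrow> view" where
  "exchange A E \<sigma> v =
     observe (Received (\<lambda>u. if u \<in> neighbors E v then message A (\<sigma> u) v else [])) (\<sigma> v)"

text \<open>
  \<open>run A V E P t\<close> is the distribution of the local states after \<open>t\<close> communication rounds
  and the local computation following the last of them.
\<close>

primrec run ::
    "protocol \<Rightarrow> nat set \<Rightarrow> nat set set \<Rightarrow> (nat \<times> nat) set \<Rightarrow> nat \<Rightarrow> (nat \<Rightarrow> view) pmf" where
  "run A V E P 0 = toss A V (initial_view E P)"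
| "run A V E P (Suc t) = bind_pmf (run A V E P t) (\<lambda>\<sigma>. toss A V (exchange A E \<sigma>))"


section \<open>The pairwise spanner problem\<close>

text \<open>
  Inputs with \<open>n\<close> nodes and \<open>p\<close> pairs.  Identifiers range below \<open>n ^ K\<close>, i.e. they have
  at most \<open>\<lceil>K log n\<rceil>\<close> bits; for every \<open>K \<ge> 1\<close> there are enough of them for \<open>n\<close> nodes.
\<close>

definition inputs ::
    "nat \<Rightarrow> nat \<Rightarrow> nat \<Rightarrow> (nat set \<times> nat set set \<times> (nat \<times> nat) set) set" where
  "inputs K n p =
     {(V, E, P). simple_graph V E \<and> card V = n \<and> V \<subseteq> {..<n ^ K} \<and> P \<subseteq> V \<times> V \<and> card P = p}"

definition inputs_diameter_le ::
    "nat \<Rightarrow> nat \<Rightarrow> nat \<Rightarrow> nat \<Rightarrow> (nat set \<times> nat set set \<times> (nat \<times> nat) set) set" where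
  "inputs_diameter_le D K n p = {(V, E, P)\<in>inputs K n p. diameter_le V E D}"

text \<open>
  The local outputs have to agree on one subgraph \<open>H\<close>: each node outputs exactly its
  neighborhood in \<open>H\<close>.
\<close>

definition correct_output ::
    "real \<Rightarrow> nat set \<Rightarrow> nat set set \<Rightarrow> (nat \<times> nat) set \<Rightarrow> (nat \<Rightarrow> nat set) \<Rightarrow> bool" where
  "correct_output m V E P out \<longleftrightarrow>
     (\<exists>H. plus2_pairwise_spanner E P H \<and> real (card H) \<le> m \<and> (\<forall>v\<in>V. out v = neighbors H v))"

text \<open>
  \<open>solves_in A T q m I\<close>: on every input in \<open>I\<close>, with probability at least \<open>q\<close>, the protocol
  has produced after \<open>T\<close> rounds a pairwise spanner with at most \<open>m\<close> edges.
\<close>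

definition solves_in ::
    "protocol \<Rightarrow> nat \<Rightarrow> real \<Rightarrow> real \<Rightarrow> (nat set \<times> nat set set \<times> (nat \<times> nat) set) set \<Rightarrow> bool" where
  "solves_in A T q m I \<longleftrightarrow>
     (\<forall>(V, E, P)\<in>I.
        measure_pmf.prob (run A V E P T)
          {\<sigma>. correct_output m V E P (\<lambda>v. result A (\<sigma> v))} \<ge> q)"

end

theory Submission
  imports Defs "HOL-Number_Theory.Cong" "HOL-Real_Asymp.Real_Asymp"
begin

text \<open>
  Let \<open>q\<close> be a prime of order \<open>sqrt n\<close> and take the point-line incidence graph over the field with
  \<open>q\<close> elements: \<open>2 * q\<^sup>2\<close> nodes, \<open>q\<^sup>3\<close> edges and no 4-cycle.  Attach a pendant node to each of
  its nodes.  If the pendants of the ends of an incidence form a pair, every (+2)-spanner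
  has to contain that incidence.  Only the pendants know the pairs, and everything that the
  other nodes learn about them passes through the \<open>2 * q\<^sup>2\<close> pendant edges.  Without that
  information the other nodes produce some set of at most half of the incidences, which contains a
  random \<open>p\<close>-set of incidences with probability at most \<open>1 / 2 ^ p\<close>.  Guessing the messages on the
  pendant edges instead of receiving them costs a factor equal to the number of possible transcripts,
  so there must be about \<open>2 ^ p\<close> of them.  A hub at distance 2 from each node of the incidence graph
  makes the diameter constant and still leaves no short detour.
\<close>

section \<open>Primes in dyadic intervals\<close>

text \<open>
  The recurrence \<open>1 / a (m + 1) (k + 1) = 1 / a m k - 1 / a (m + 1) k\<close> of the Leibniz triangle
  \<open>a m k = k * (m choose k)\<close>, multiplied by \<open>L\<close>.
\<close>

lemma mult_binomial_dvd:
  fixes L m k :: nat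
  assumes "\<And>j. j \<ge> 1 \<Longrightarrow> j \<le> m \<Longrightarrow> j dvd L" "1 \<le> k" "k \<le> m"
  shows "k * (m choose k) dvd L"
  using assms(2,1,3)
proof (induction k arbitrary: m rule: dec_induct)
  case base
  then show ?case by simp
next
  case (step k)
  then obtain r where m: "m = Suc r" "k \<le> r" by (cases m) auto
  have "k * (r choose k) dvd L" "k * (Suc r choose k) dvd L"
    using step.IH[of r] step.IH[of "Suc r"] step.prems m by auto
  then obtain u v where u: "L = k * (r choose k) * u" and v: "L = k * (Suc r choose k) * v"
    unfolding dvd_def by blast
  define a b :: int where "a = int (r choose k)" and "b = int (Suc r choose k)"
  have c: "int (Suc k * (Suc r choose Suc k)) = int (Suc r) * a"
    unfolding a_def by (metis Suc_times_binomial_eq mult.commute of_nat_mult)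
  have ab: "int (Suc r - k) * b = int (Suc r) * a"
    unfolding a_def b_def using binomial_absorb_comp[of "Suc r" k] m
    by (metis diff_Suc_1 of_nat_mult)
  have pos: "a > 0" "k > 0" using m step.hyps by (auto simp: a_def)
  have uv: "a * int u = b * int v"
    using u v pos by (simp add: a_def b_def) (metis mult.assoc mult_left_cancel of_nat_mult not_gr_zero)
  \<comment> \<open>Here \<open>u\<close> and \<open>v\<close> are the quotients of \<open>L\<close>
    by two entries of the triangle, and \<open>c\<close> rewrites the third as
    \<open>Suc r * a\<close>; this is the recurrence cleared of denominators. The integers allow the
    difference.\<close>
  have "int L = int (Suc r) * a * (int u - int v)"
  proof -
    have "int (Suc r) * a * (int u - int v) = int (Suc r) * (b * int v) - int (Suc r - k) * b * int v"
      using uv ab by (simp add: right_diff_distrib)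
    also have "\<dots> = int k * (b * int v)"
      using m by (simp add: of_nat_diff algebra_simps)
    also have "\<dots> = int L" using v by (simp add: b_def)
    finally show ?thesis by simp
  qed
  then have "int (Suc k * (Suc r choose Suc k)) dvd int L"
    using c by simp
  then show ?case using m by (simp only: of_nat_dvd_iff)
qed

lemma prod_primes_dvd_nat:
  fixes n :: nat
  assumes "finite A" "\<And>p. p \<in> A \<Longrightarrow> prime p" "\<And>p. p \<in> A \<Longrightarrow> p dvd n"
  shows "\<Prod>A dvd n"
  using assms
proof (induction A)
  case (insert p A)
  have "coprime p (\<Prod>A)"
    using insert by (intro prod_coprime_right) (auto intro: primes_coprime)
  with insert show ?case by (simp add: divides_mult)
qed simp

text \<open>Each doubling from \<open>n\<close> to \<open>2 * n\<close> adds only primes that divide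
  the central binomial coefficient, whose size is at most \<open>4 ^ n\<close>; the exponents form a
  geometric sum.\<close>

lemma primorial_power2_le: "(\<Prod>{p::nat. prime p \<and> p \<le> 2 ^ k}) \<le> 4 ^ (2 ^ k)"
proof (induction k)
  case 0
  have "{p::nat. prime p \<and> p \<le> 2 ^ 0} = {}" by (auto dest: prime_ge_2_nat)
  then show ?case by (metis prod.empty one_le_power one_le_numeral)
next
  case (Suc k)
  define n :: nat where "n = 2 ^ k"
  define A where "A = {p. prime p \<and> n < p \<and> p \<le> 2 * n}"
  have split: "{p. prime p \<and> p \<le> 2 ^ Suc k} = {p. prime p \<and> p \<le> n} \<union> A"
    by (auto simp: A_def n_def)
  have "\<Prod>A dvd (2 * n choose n)"
  proof (rule prod_primes_dvd_nat)
    fix p assume "p \<in> A"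
    then have p: "prime p" "n < p" "p \<le> 2 * n" by (auto simp: A_def)
    have "p dvd fact (2 * n)" using p by (simp add: prime_dvd_fact_iff)
    also have "fact (2 * n) = fact n * fact n * (2 * n choose n)"
      using binomial_fact_lemma[of n "2 * n"] by (simp add: mult_2)
    finally show "p dvd (2 * n choose n)"
      using p by (auto simp: prime_dvd_mult_iff prime_dvd_fact_iff)
  qed (auto simp: A_def)
  then have "\<Prod>A \<le> (2 * n choose n)" by (rule dvd_imp_le) simp
  also have "\<dots> \<le> 2 ^ (2 * n)" by (rule binomial_le_pow2)
  finally have A: "\<Prod>A \<le> 4 ^ n" by (simp add: power_mult)
  have "\<Prod>{p. prime p \<and> p \<le> 2 ^ Suc k} = \<Prod>{p. prime p \<and> p \<le> n} * \<Prod>A"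
    unfolding split by (rule prod.union_disjoint) (auto simp: A_def)
  also have "\<dots> \<le> 4 ^ n * 4 ^ n"
    using Suc.IH A by (intro mult_mono) (auto simp: n_def)
  finally show ?case by (simp add: n_def power_add[symmetric] mult_2)
qed

text \<open>
  With \<open>n = 2 ^ (k + 1)\<close> and \<open>m = 2 * n\<close>, the number \<open>n * (m choose n)\<close> divides the product \<open>L\<close> of
  the maximal prime powers up to \<open>m\<close>.  If no prime lies between \<open>2 ^ k\<close> and \<open>m\<close>, this product is too
  small, as only primes up to \<open>sqrt m\<close> occur in it with an exponent greater than 1.
\<close>

lemma prime_between_powers2_aux:
  assumes "\<not> (\<exists>q::nat. prime q \<and> 2 ^ k < q \<and> q \<le> 2 ^ (k + 2))"
  shows "real (4 ^ (2 ^ k)) \<le> 2 * real (2 ^ (k + 2)) powr sqrt (2 ^ (k + 2))"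
proof -
  define n m x s :: nat where "n = 2 ^ (k + 1)" and "m = 2 ^ (k + 2)" and "x = 2 ^ k"
    and "s = nat \<lfloor>sqrt (real m)\<rfloor>"
  have m: "m = 2 * n" "n = 2 * x" "m \<ge> 1" "n \<ge> 1" by (auto simp: n_def m_def x_def)
  define Q where "Q = {p. prime p \<and> p \<le> x}"
  define e where "e = (\<lambda>p::nat. Max {i. p ^ i \<le> m})"
  have fin: "finite {i. p ^ i \<le> m}" if "p \<ge> 2" for p
  proof (rule finite_subset)
    show "{i. p ^ i \<le> m} \<subseteq> {..m}"
    proof safe
      fix i assume "p ^ i \<le> m"
      moreover have "i < 2 ^ i" by simp
      moreover have "(2::nat) ^ i \<le> p ^ i" using that by (intro power_mono) auto
      ultimately show "i \<le> m" by linarith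
    qed
  qed simp
  have e_le: "p ^ e p \<le> m" if "p \<ge> 2" for p
  proof -
    have "0 \<in> {i. p ^ i \<le> m}" using m by simp
    then have "e p \<in> {i. p ^ i \<le> m}"
      unfolding e_def by (intro Max_in fin that) blast
    then show ?thesis by simp
  qed
  have le_e: "i \<le> e p" if "p \<ge> 2" "p ^ i \<le> m" for p i
    unfolding e_def using that fin by (intro Max_ge) auto
  define L where "L = (\<Prod>p\<in>Q. p ^ e p)"
  have Q: "finite Q" "\<And>p. p \<in> Q \<Longrightarrow> prime p" "\<And>p. p \<in> Q \<Longrightarrow> p \<ge> 2"
    by (auto simp: Q_def dest: prime_ge_2_nat)
  have L0: "L > 0" unfolding L_def using Q(2) by (intro prod_pos) (auto dest: prime_gt_0_nat)
  have "j dvd L" if "j \<ge> 1" "j \<le> m" for j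
  proof (rule multiplicity_le_imp_dvd)
    fix p :: nat assume p: "prime p"
    show "multiplicity p j \<le> multiplicity p L"
    proof (cases "p \<in> Q")
      case True
      have "p ^ multiplicity p j \<le> m"
        using dvd_imp_le[OF multiplicity_dvd[of p j]] that by linarith
      then have "multiplicity p j \<le> e p" using Q(3)[OF True] by (intro le_e)
      also have "e p = multiplicity p L"
        unfolding L_def using Q True p by (subst multiplicity_prod_prime_powers) auto
      finally show ?thesis .
    next
      case False
      then have "x < p" using p by (auto simp: Q_def)
      \<comment> \<open>By assumption no prime lies above \<open>x\<close> and up to
        \<open>m\<close>, so a prime outside \<open>Q\<close> exceeds \<open>m\<close> and cannot
        divide \<open>j\<close>.\<close>
      then have "p > m" using p assms unfolding m_def x_def by (meson not_le)
      then have "\<not> p dvd j" using that by (auto dest: dvd_imp_le)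
      then show ?thesis by (simp add: not_dvd_imp_multiplicity_0)
    qed
  qed (use that L0 in auto)
  then have "n * (m choose n) dvd L"
    using m by (intro mult_binomial_dvd) auto
  then have "n * (m choose n) \<le> L" using L0 by (rule dvd_imp_le)
  then have "real n * real (m choose n) \<le> real L" by (metis of_nat_le_iff of_nat_mult)
  moreover have "4 ^ n / (2 * real n) \<le> real (m choose n)"
    using central_binomial_lower_bound[of n] m by simp
  ultimately have low: "4 ^ n \<le> 2 * real L"
    using m by (simp add: field_simps)
  \<comment> \<open>Above \<open>sqrt m\<close> the exponent is at most 1. Below it the crude factor
    \<open>m\<close> suffices, since there are at most \<open>s\<close> such primes.\<close>
  have e1: "p ^ e p \<le> (if p \<le> s then m else 1) * p" if "p \<in> Q" for p
  proof (cases "p \<le> s")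
    case True
    have "p ^ e p * 1 \<le> m * p"
      using e_le[OF Q(3)[OF that]] Q(3)[OF that] by (intro mult_le_mono) auto
    then show ?thesis using True by simp
  next
    case False
    have p2: "p \<ge> 2" using Q(3) that .
    have "sqrt m < p" using False by (simp add: s_def) linarith
    then have "real m < real p ^ 2" using power_strict_mono[of "sqrt m" p 2] by simp
    then have "m < p ^ 2" by (metis of_nat_less_iff of_nat_power)
    with e_le[OF p2] have "p ^ e p < p ^ 2" by (rule le_less_trans)
    with p2 have "e p < 2" by (intro power_less_imp_less_exp[of p "e p" 2]) auto
    then have "p ^ e p \<le> p ^ 1" using p2 by (intro power_increasing) auto
    then show ?thesis using False by simp
  qed
  have "L \<le> (\<Prod>p\<in>Q. (if p \<le> s then m else 1) * p)"
    unfolding L_def by (intro prod_mono) (use e1 in auto)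
  also have "\<dots> = (\<Prod>p\<in>Q. if p \<le> s then m else 1) * \<Prod>Q"
    by (simp add: prod.distrib)
  also have "(\<Prod>p\<in>Q. if p \<le> s then m else 1) = m ^ card {p \<in> Q. p \<le> s}"
    using Q(1) by (simp add: prod.If_cases Collect_conj_eq)
  also have "m ^ card {p \<in> Q. p \<le> s} * \<Prod>Q \<le> m ^ s * 4 ^ x"
  proof (intro mult_mono power_increasing)
    have "card {p \<in> Q. p \<le> s} \<le> card {1..s}"
      by (intro card_mono) (auto simp: Q_def dest: prime_ge_1_nat)
    then show "card {p \<in> Q. p \<le> s} \<le> s" by simp
    show "\<Prod>Q \<le> 4 ^ x" using primorial_power2_le[of k] by (simp add: Q_def x_def)
  qed (use m in auto)
  finally have "real L \<le> real m ^ s * 4 ^ x"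
    unfolding of_nat_le_iff[symmetric, where 'a = real] by simp
  \<comment> \<open>As \<open>n = 2 * x\<close>, one factor cancels against the primorial bound
    \<open>4 ^ x\<close>, and the other remains to contradict the subexponential term.\<close>
  moreover have "(4::real) ^ n = 4 ^ x * 4 ^ x" by (simp add: m(2) mult_2 power_add)
  ultimately have "4 ^ x * 4 ^ x \<le> (2 * real m ^ s) * 4 ^ x" using low by linarith
  then have "4 ^ x \<le> 2 * real m ^ s" by (rule mult_right_le_imp_le) simp
  also have "real m ^ s = real m powr real s" using m(3) by (simp add: powr_realpow)
  also have "\<dots> \<le> real m powr sqrt m"
    using m(3) by (intro powr_mono) (auto simp: s_def)
  finally show ?thesis by (simp add: x_def m_def)
qed

text \<open>Without such a prime, logarithms would bound \<open>2 ^ k\<close> by a multiple of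
  \<open>k * 2 powr (k / 2)\<close>, up to lower order terms, which fails for large
  \<open>k\<close>.\<close>

lemma eventually_prime_between_powers2:
  "\<forall>\<^sub>F k in sequentially. \<exists>q::nat. prime q \<and> 2 ^ k < q \<and> q \<le> 2 ^ (k + 2)"
proof -
  have "\<forall>\<^sub>F k::nat in sequentially. 2 powr k * ln 4 > ln 2 + sqrt (4 * 2 powr k) * ((real k + 2) * ln 2)"
    by real_asymp
  then show ?thesis
  proof eventually_elim
    case (elim k)
    show ?case
    proof (rule ccontr)
      assume "\<not> ?thesis"
      from prime_between_powers2_aux[OF this]
      have "ln (real (4 ^ (2 ^ k))) \<le> ln (2 * real (2 ^ (k + 2)) powr sqrt (2 ^ (k + 2)))"
        by (subst ln_le_cancel_iff) auto
      moreover have "ln 4 = 2 * ln (2::real)" using ln_realpow[of 2 2] by simp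
      ultimately have "2 ^ k * ln 4 \<le> ln 2 + sqrt (2 ^ (k + 2)) * ((real k + 2) * ln 2)"
        by (simp add: ln_realpow ln_mult ln_powr algebra_simps)
      then show False using elim by (simp add: powr_realpow)
    qed
  qed
qed

text \<open>The lower bound on \<open>n\<close> leaves room for the hard graph; the upper bound
  makes \<open>q ^ 3\<close> of order \<open>n powr (3 / 2)\<close>.\<close>

lemma eventually_prime_square:
  "\<forall>\<^sub>F n in sequentially. \<exists>q::nat. prime q \<and> 6 * q ^ 2 < n \<and> n \<le> 400 * q ^ 2"
proof -
  obtain k0 where k0: "\<And>k. k \<ge> k0 \<Longrightarrow> \<exists>q::nat. prime q \<and> 2 ^ k < q \<and> q \<le> 2 ^ (k + 2)"
    using eventually_prime_between_powers2 by (auto simp: eventually_sequentially)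
  have "\<exists>q::nat. prime q \<and> 6 * q ^ 2 < n \<and> n \<le> 400 * q ^ 2" if n: "n > 96 * 4 ^ k0" for n :: nat
  proof -
    \<comment> \<open>The factor is 96 = 6 * 16: the prime satisfies
      \<open>q ^ 2 \<le> 16 * 4 ^ k\<close>, so \<open>96 * 4 ^ k < n\<close> gives
      \<open>6 * q ^ 2 < n\<close>.\<close>
    define k where "k = (LEAST k. n \<le> 96 * 4 ^ (k + 1))"
    have "n < 4 ^ n" by (rule less_exp[THEN less_le_trans]) (simp add: power_mono)
    then have "n \<le> 96 * 4 ^ (n + 1)" by simp
    then have up: "n \<le> 96 * 4 ^ (k + 1)" unfolding k_def by (rule LeastI)
    have low: "96 * 4 ^ k < n"
    proof (cases k)
      case 0
      have "(1::nat) \<le> 4 ^ k0" by simp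
      then show ?thesis using n unfolding 0 power_0 by linarith
    next
      case (Suc j)
      then have "\<not> n \<le> 96 * 4 ^ (j + 1)" unfolding k_def by (intro not_less_Least) simp
      then show ?thesis using Suc by simp
    qed
    have "(4::nat) ^ k0 < 4 ^ (k + 1)" using n up by linarith
    then have "k \<ge> k0" by (simp del: power_Suc)
    then obtain q :: nat where q: "prime q" "2 ^ k < q" "q \<le> 2 ^ (k + 2)" using k0 by blast
    have "(2 ^ k) ^ 2 \<le> q ^ 2" "q ^ 2 \<le> (2 ^ (k + 2)) ^ 2"
      using q by (intro power_mono; simp)+
    moreover have "(2 ^ k) ^ 2 = (4::nat) ^ k" "(2 ^ (k + 2)) ^ 2 = 16 * (4::nat) ^ k"
      by (simp_all add: power_mult[symmetric] power_mult_distrib power_add mult.commute[of k 2])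
        (simp_all add: power_mult)
    ultimately have "6 * q ^ 2 < n" "n \<le> 400 * q ^ 2" using up low by simp_all
    with q(1) show ?thesis by blast
  qed
  then show ?thesis unfolding eventually_sequentially by (intro exI[of _ "96 * 4 ^ k0 + 1"]) auto
qed

section \<open>The hard graph\<close>

text \<open>
  The point \<open>(x, y)\<close> is the number \<open>x * q + y\<close>, and the line \<open>y = m * x + b\<close> is the number
  \<open>q ^ 2 + m * q + b\<close>.
\<close>

definition incidences :: "nat \<Rightarrow> (nat \<times> nat) set" where
  "incidences q =
     (\<lambda>(x, m, b). (x * q + (m * x + b) mod q, q ^ 2 + m * q + b)) ` ({..<q} \<times> {..<q} \<times> {..<q})"

section \<open>The incidence graph: its size and the absence of 4-cycles\<close>

lemma mult_add_less_power2:
  fixes a b q :: nat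
  assumes "a < q" "b < q"
  shows "a * q + b < q ^ 2"
proof -
  have "a * q + b < a * q + q" using assms by simp
  also have "\<dots> = (a + 1) * q" by simp
  also have "\<dots> \<le> q * q" using assms by (intro mult_le_mono1) simp
  finally show ?thesis by (simp add: power2_eq_square)
qed

lemma mult_add_eq_iff:
  fixes a b c d q :: nat
  assumes "b < q" "d < q"
  shows "a * q + b = c * q + d \<longleftrightarrow> a = c \<and> b = d"
proof
  assume eq: "a * q + b = c * q + d"
  have "(a * q + b) div q = a" "(c * q + d) div q = c"
       "(a * q + b) mod q = b" "(c * q + d) mod q = d" using assms by auto
  with eq show "a = c \<and> b = d" by metis
qed simp

lemma incidences_bounds:
  "(i, j) \<in> incidences q \<Longrightarrow> i < q ^ 2"
  "(i, j) \<in> incidences q \<Longrightarrow> q ^ 2 \<le> j"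
  "(i, j) \<in> incidences q \<Longrightarrow> j < 2 * q ^ 2"
  by (auto simp: incidences_def mult_2 add.assoc intro!: mult_add_less_power2)

lemma finite_incidences: "finite (incidences q)"
  by (simp add: incidences_def)

lemma card_incidences: "card (incidences q) = q ^ 3"
proof -
  have "inj_on (\<lambda>(x, m, b). (x * q + (m * x + b) mod q, q ^ 2 + m * q + b))
      ({..<q} \<times> {..<q} \<times> {..<q})"
    by (rule inj_onI) (auto simp: mult_add_eq_iff add.assoc)
  then show ?thesis
    unfolding incidences_def by (subst card_image) (auto simp: power3_eq_cube)
qed

text \<open>The four incidence congruences combine to \<open>(m - m') * (x - x') = 0\<close> modulo
  \<open>q\<close>. As \<open>q\<close> is prime, one factor vanishes, which identifies the lines or
  the points.\<close>

lemma incidences_no_square: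
  assumes q: "prime q"
    and "(i, j) \<in> incidences q" "(i, j') \<in> incidences q" "(i', j) \<in> incidences q" "(i', j') \<in> incidences q"
  shows "i = i' \<or> j = j'"
proof -
  have *: "[y = m * x + b] (mod q)"
    if "(x * q + y, q ^ 2 + m * q + b) \<in> incidences q" "y < q" "b < q" for x y m b
    using that by (auto simp: incidences_def mult_add_eq_iff add.assoc cong_def)
  have ex: "\<exists>x y. i = x * q + y \<and> x < q \<and> y < q" if "(i, j) \<in> incidences q" for i j
    using that by (fastforce simp: incidences_def)
  have ey: "\<exists>m b. j = q ^ 2 + m * q + b \<and> m < q \<and> b < q" if "(i, j) \<in> incidences q" for i j
    using that by (fastforce simp: incidences_def)
  obtain x y where i: "i = x * q + y" "x < q" "y < q" using ex assms(2) by blast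
  obtain x' y' where i': "i' = x' * q + y'" "x' < q" "y' < q" using ex assms(4) by blast
  obtain m b where j: "j = q ^ 2 + m * q + b" "m < q" "b < q" using ey assms(2) by blast
  obtain m' b' where j': "j' = q ^ 2 + m' * q + b'" "m' < q" "b' < q" using ey assms(3) by blast
  have c: "[y = m * x + b] (mod q)" "[y = m' * x + b'] (mod q)"
     "[y' = m * x' + b] (mod q)" "[y' = m' * x' + b'] (mod q)"
    using * assms i i' j j' by blast+
  have d: "int q dvd int y - (int m * int x + int b)" "int q dvd int y - (int m' * int x + int b')"
     "int q dvd int y' - (int m * int x' + int b)" "int q dvd int y' - (int m' * int x' + int b')"
    using c unfolding cong_int_iff[symmetric] cong_iff_dvd_diff by simp_all
  have small: "a = b" if "int q dvd int a - int b" "a < q" "b < q" for a b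
    using that by (metis cong_iff_dvd_diff cong_int_iff cong_less_modulus_unique_nat)
  have "int q dvd (int m - int m') * (int x - int x')"
  proof -
    have "(int m - int m') * (int x - int x') =
      (int y - (int m' * int x + int b')) - (int y - (int m * int x + int b))
      + (int y' - (int m * int x' + int b)) - (int y' - (int m' * int x' + int b'))"
      by (simp add: algebra_simps)
    then show ?thesis using dvd_diff[OF dvd_add[OF dvd_diff[OF d(2,1)] d(3)] d(4)] by (simp only:)
  qed
  then consider "int q dvd int m - int m'" | "int q dvd int x - int x'"
    using q by (metis prime_dvd_mult_iff prime_nat_int_transfer)
  then show ?thesis
  proof cases
    case 1
    then have m: "m = m'" using small j j' by blast
    have "int q dvd (int y - (int m' * int x + int b')) - (int y - (int m * int x + int b))"
      by (rule dvd_diff[OF d(2,1)])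
    then have "int q dvd int b - int b'" by (simp add: m)
    then have "b = b'" using small j j' by blast
    with m j j' show ?thesis by simp
  next
    case 2
    then have x: "x = x'" using small i i' by blast
    have "int q dvd (int y - (int m * int x + int b)) - (int y' - (int m * int x' + int b))"
      by (rule dvd_diff[OF d(1,3)])
    then have "int q dvd int y - int y'" by (simp add: x)
    then have "y = y'" using small i i' by blast
    with x i i' show ?thesis by simp
  qed
qed

text \<open>
  The incidence graph \<open>I\<close> lives on \<open>{..<2 * N}\<close>; node \<open>i\<close> of it has the pendant \<open>i + 2 * N\<close> and is
  joined through \<open>i + 4 * N\<close> to the hub \<open>6 * N\<close>.  The nodes above \<open>6 * N\<close> pad the graph to \<open>n\<close> nodes.
\<close>

definition hard_adj :: "nat \<Rightarrow> (nat \<times> nat) set \<Rightarrow> nat \<Rightarrow> nat \<Rightarrow> nat \<Rightarrow> bool" where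
  "hard_adj N I n u v \<longleftrightarrow> (u, v) \<in> I
     \<or> u < 2 * N \<and> (v = u + 2 * N \<or> v = u + 4 * N)
     \<or> (4 * N \<le> u \<and> u < 6 * N \<or> 6 * N < u \<and> u < n) \<and> v = 6 * N"

definition hard_edges :: "nat \<Rightarrow> (nat \<times> nat) set \<Rightarrow> nat \<Rightarrow> nat set set" where
  "hard_edges N I n = {{u, v} | u v. hard_adj N I n u v}"

lemma doubleton_mem_hard_edges_iff:
  "{u, v} \<in> hard_edges N I n \<longleftrightarrow> hard_adj N I n u v \<or> hard_adj N I n v u"
  by (auto simp: hard_edges_def doubleton_eq_iff)

section \<open>Walks and distances\<close>

lemma graph_dist_leI:
  assumes "xs \<in> walks E u v" "length xs \<le> Suc k"
  shows "graph_dist E u v \<le> enat k"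
proof -
  have "graph_dist E u v \<le> enat (length xs - 1)"
    unfolding graph_dist_def using assms(1) by (rule INF_lower)
  also have "\<dots> \<le> enat k" using assms(2) by simp
  finally show ?thesis .
qed

lemma graph_dist_leE:
  assumes "graph_dist E u v \<le> enat k"
  obtains xs where "xs \<in> walks E u v" "length xs \<le> Suc k"
proof -
  have "walks E u v \<noteq> {}"
    using assms by (auto simp: graph_dist_def top_enat_def)
  then have "graph_dist E u v \<in> (\<lambda>xs. enat (length xs - 1)) ` walks E u v"
    unfolding graph_dist_def by (metis all_not_in_conv image_eqI wellorder_InfI)
  then show ?thesis using assms that by auto
qed

lemma graph_dist_commute: "graph_dist E u v = graph_dist E v u"
proof -
  have le: "graph_dist E u v \<le> graph_dist E v u" for u v
    unfolding graph_dist_def[of E v u]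
  proof (rule INF_greatest)
    fix xs assume "xs \<in> walks E v u"
    then have "rev xs \<in> walks E u v"
      by (auto simp: walks_def hd_rev last_rev successively_rev insert_commute)
    then show "graph_dist E u v \<le> enat (length xs - 1)"
      by (rule graph_dist_leI) auto
  qed
  show ?thesis using le[of u v] le[of v u] by (rule antisym)
qed

lemma graph_dist_triangle:
  assumes "graph_dist E u w \<le> enat k" "graph_dist E w v \<le> enat l"
  shows "graph_dist E u v \<le> enat (k + l)"
proof -
  obtain xs where xs: "xs \<in> walks E u w" "length xs \<le> Suc k" using assms(1) by (rule graph_dist_leE)
  obtain ys where ys: "ys \<in> walks E w v" "length ys \<le> Suc l" using assms(2) by (rule graph_dist_leE)
  obtain zs where zs: "ys = w # zs" using ys by (cases ys) (auto simp: walks_def)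
  have "xs @ zs \<in> walks E u v"
    using xs ys zs by (cases zs) (auto simp: walks_def successively_append_iff)
  moreover have "length (xs @ zs) \<le> Suc (k + l)" using xs ys zs by simp
  ultimately show ?thesis by (rule graph_dist_leI)
qed

section \<open>The hard graph: its diameter and the edges forced into a spanner\<close>

lemma graph_dist_hub_le:
  assumes N: "6 * N < n" and u: "u < n"
  shows "graph_dist (hard_edges N I n) u (6 * N) \<le> enat 3"
proof -
  let ?E = "hard_edges N I n" and ?h = "6 * N"
  note mem = doubleton_mem_hard_edges_iff hard_adj_def
  consider "u < 2 * N" | "2 * N \<le> u" "u < 4 * N" | "4 * N \<le> u" "u \<noteq> ?h" | "u = ?h" by linarith
  then have "\<exists>xs. xs \<in> walks ?E u ?h \<and> length xs \<le> Suc 3"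
  proof cases
    case 1
    then have "[u, u + 4 * N, ?h] \<in> walks ?E u ?h" by (auto simp: walks_def mem)
    then show ?thesis by (intro exI[of _ "[u, u + 4 * N, ?h]"]) simp
  next
    case 2
    \<comment> \<open>A pendant is the only kind of node that takes three steps here: to its node,
      to the joining node of that node, to the hub.\<close>
    then have "[u, u - 2 * N, u + 2 * N, ?h] \<in> walks ?E u ?h" by (auto simp: walks_def mem)
    then show ?thesis by (intro exI[of _ "[u, u - 2 * N, u + 2 * N, ?h]"]) simp
  next
    case 3
    then have "[u, ?h] \<in> walks ?E u ?h" using u by (auto simp: walks_def mem)
    then show ?thesis by (intro exI[of _ "[u, ?h]"]) simp
  next
    case 4
    then have "[u] \<in> walks ?E u ?h" by (auto simp: walks_def)
    then show ?thesis by (intro exI[of _ "[u]"]) simp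
  qed
  then show ?thesis using graph_dist_leI by blast
qed

lemma diameter_hard_edges:
  assumes "6 * N < n"
  shows "diameter_le {..<n} (hard_edges N I n) 6"
  unfolding diameter_le_def
proof (intro ballI)
  fix u v assume "u \<in> {..<n}" "v \<in> {..<n}"
  then have "graph_dist (hard_edges N I n) u (6 * N) \<le> enat 3"
    "graph_dist (hard_edges N I n) (6 * N) v \<le> enat 3"
    using graph_dist_hub_le[OF assms, of u I] graph_dist_hub_le[OF assms, of v I]
    by (simp_all add: graph_dist_commute[of _ "6 * N" v])
  from graph_dist_triangle[OF this] show "graph_dist (hard_edges N I n) u v \<le> enat 6" by simp
qed

lemma simple_graph_hard_edges:
  assumes "6 * N < n" "\<And>i j. (i, j) \<in> I \<Longrightarrow> i < N \<and> N \<le> j \<and> j < 2 * N"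
  shows "simple_graph {..<n} (hard_edges N I n)"
proof -
  have "e \<subseteq> {..<n} \<and> card e = 2" if "e \<in> hard_edges N I n" for e
  proof -
    obtain u v where e: "e = {u, v}" using \<open>e \<in> _\<close> unfolding hard_edges_def by auto
    have "u \<noteq> v \<and> u < n \<and> v < n"
      using that assms(1) unfolding e doubleton_mem_hard_edges_iff hard_adj_def
      by (elim disjE conjE) (auto dest!: assms(2))
    then show ?thesis by (simp add: e)
  qed
  then show ?thesis by (simp add: simple_graph_def)
qed

text \<open>The pendants are at distance at most 3, so the spanner joins them by a walk of at most 5
  edges. Without \<open>{i, j}\<close> this leaves at most 3 edges for a detour from
  \<open>i\<close> to \<open>j\<close>. Inside \<open>I\<close>, bipartiteness and the absence of
  4-cycles exclude it, and the route through the hub takes 4.\<close>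

lemma spanner_contains_incidence:
  assumes I: "\<And>i j. (i, j) \<in> I \<Longrightarrow> i < N \<and> N \<le> j \<and> j < 2 * N"
    and sq: "\<And>i j i' j'. (i, j) \<in> I \<Longrightarrow> (i, j') \<in> I \<Longrightarrow> (i', j) \<in> I \<Longrightarrow> (i', j') \<in> I \<Longrightarrow> i = i' \<or> j = j'"
    and ij: "(i, j) \<in> I"
    and H: "plus2_pairwise_spanner (hard_edges N I n) P H"
    and P: "(i + 2 * N, j + 2 * N) \<in> P"
  shows "{i, j} \<in> H"
proof (rule ccontr)
  assume nH: "{i, j} \<notin> H"
  let ?E = "hard_edges N I n"
  have b: "i < N" "N \<le> j" "j < 2 * N" using I ij by auto
  note mem = doubleton_mem_hard_edges_iff hard_adj_def
  have "[i + 2 * N, i, j, j + 2 * N] \<in> walks ?E (i + 2 * N) (j + 2 * N)"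
    using b ij by (auto simp: walks_def mem)
  then have "graph_dist ?E (i + 2 * N) (j + 2 * N) \<le> enat 3"
    by (rule graph_dist_leI) simp
  then have "graph_dist ?E (i + 2 * N) (j + 2 * N) + 2 \<le> enat 3 + 2" by (rule add_right_mono)
  moreover have "graph_dist H (i + 2 * N) (j + 2 * N) \<le> graph_dist ?E (i + 2 * N) (j + 2 * N) + 2"
    using H P by (auto simp: plus2_pairwise_spanner_def)
  moreover have "enat 3 + 2 = enat 5" by (simp add: numeral_eq_enat)
  ultimately have "graph_dist H (i + 2 * N) (j + 2 * N) \<le> enat 5" by order
  then obtain xs where xs: "xs \<in> walks H (i + 2 * N) (j + 2 * N)" "length xs \<le> Suc 5"
    by (rule graph_dist_leE)
  \<comment> \<open>\<open>f\<close> is a lower bound for the distance from the pendant of \<open>i\<close> once \<open>{i, j}\<close> is removed.\<close>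
  define f where "f v = (if v = i + 2 * N then 0 else if v = i then 1
     else if {i, v} \<in> ?E \<and> v \<noteq> j then 2
     else if v = j + 2 * N then 6 else if v = j then 5
     else if {v, j} \<in> ?E then 4 else (3::nat))" for v
  have nbr_i: "u = i + 2 * N \<or> u = i + 4 * N \<or> (i, u) \<in> I" if "{i, u} \<in> ?E" for u
    using that unfolding mem by (elim disjE conjE; use b in \<open>auto dest: I\<close>)
  have nbr_j: "u = j + 2 * N \<or> u = j + 4 * N \<or> (u, j) \<in> I" if "{u, j} \<in> ?E" for u
    using that unfolding mem by (elim disjE conjE; use b in \<open>auto dest: I\<close>)
  have pend: "u = k" if "{u, k + 2 * N} \<in> ?E" "k < 2 * N" for u k
    using that(1) unfolding mem by (elim disjE conjE; use that(2) b in \<open>auto dest: I\<close>)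
  have star: "u = k \<or> u = 6 * N" if "{u, k + 4 * N} \<in> ?E" "k < 2 * N" for u k
    using that(1) unfolding mem by (elim disjE conjE; use that(2) b in \<open>auto dest: I\<close>)
  have self: "{i, i + 2 * N} \<in> ?E" "{j, j + 2 * N} \<in> ?E" "i \<noteq> j" "N > 0"
    using b unfolding mem by auto
  have two: False if "{i, u} \<in> ?E" "{u, j} \<in> ?E" for u
    using nbr_i[OF that(1)] nbr_j[OF that(2)] by (elim disjE; use b in \<open>auto dest!: I\<close>)
  \<comment> \<open>A path \<open>i\<close>, \<open>u\<close>, \<open>v\<close>, \<open>j\<close>
    closes up with \<open>{i, j}\<close> to a 4-cycle, which could only lie inside \<open>I\<close>;
    \<open>sq\<close> leaves the degenerate paths.\<close>
  have three: "v = i \<or> u = j" if uv: "{i, u} \<in> ?E" "{u, v} \<in> ?E" "{v, j} \<in> ?E" for u v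
  proof -
    have vu: "{v, u} \<in> ?E" using uv(2) by (simp add: insert_commute)
    consider "u = i + 2 * N" | "u = i + 4 * N" | "v = j + 2 * N" | "v = j + 4 * N"
      | "(i, u) \<in> I" "(v, j) \<in> I"
      using nbr_i[OF uv(1)] nbr_j[OF uv(3)] by blast
    then show ?thesis
    proof cases
      case 1
      then show ?thesis using pend[of v i] vu b by simp
    next
      case 2
      then have "v = i \<or> v = 6 * N" using star[of v i] vu b by simp
      then show ?thesis using nbr_j[OF uv(3)] b by (auto dest: I)
    next
      case 3
      then show ?thesis using pend[of u j] uv(2) b by simp
    next
      case 4
      then have "u = j \<or> u = 6 * N" using star[of u j] uv(2) b by simp
      then show ?thesis using nbr_i[OF uv(1)] b by (auto dest: I)
    next
      case 5
      then have "(v, u) \<in> I"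
        using uv(2) I[OF 5(1)] I[OF 5(2)] unfolding mem by (elim disjE conjE) (auto dest: I)
      then show ?thesis using sq[OF ij 5(1) 5(2)] by blast
    qed
  qed
  \<comment> \<open>Along an edge of \<open>H\<close> the bound \<open>f\<close> rises by at most 1.
    The critical jumps are from 2 to 4, excluded by \<open>three\<close>, from 2 to 5, excluded by
    \<open>two\<close>, and from 1 to 5, which would need \<open>{i, j}\<close> itself.\<close>
  have lip: "f v \<le> Suc (f u)" if "{u, v} \<in> H" for u v
  proof -
    have "{u, v} \<in> ?E" "{u, v} \<noteq> {i, j}"
      using that H nH by (auto simp: plus2_pairwise_spanner_def)
    note e = this
    then have e': "{v, u} \<in> ?E" by (simp add: insert_commute)
    consider "v = i + 2 * N \<or> v = i" | "v \<noteq> i + 2 * N" "v \<noteq> i" "{i, v} \<in> ?E" "v \<noteq> j"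
      | "v = j + 2 * N" | "v = j"
      | "v \<noteq> i + 2 * N" "v \<noteq> i" "{i, v} \<notin> ?E" "v \<noteq> j" "v \<noteq> j + 2 * N"
      by blast
    then show ?thesis
    proof cases
      case 1
      then show ?thesis by (auto simp: f_def)
    next
      case 2
      then have "u \<noteq> i + 2 * N" using e' pend[of v i] b by auto
      then show ?thesis using 2 by (auto simp: f_def)
    next
      case 3
      then have "u = j" using e pend[of u j] b by simp
      then show ?thesis using self b by (auto simp: f_def)
    next
      case 4
      then have "u \<noteq> i" "{i, u} \<notin> ?E" "{u, j} \<in> ?E" using e two by auto
      moreover from this self have "u \<noteq> i + 2 * N" by auto
      ultimately show ?thesis using 4 self b by (auto simp: f_def)
    next
      case 5
      have "u \<noteq> i + 2 * N" using 5 e' pend[of v i] b by auto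
      moreover have "u \<noteq> i" using 5 e by auto
      moreover have "u = j" if "{i, u} \<in> ?E" "{v, j} \<in> ?E" using three[OF that(1) e(1) that(2)] 5 by auto
      ultimately show ?thesis using 5 by (auto simp: f_def)
    qed
  qed
  have "f (last xs) \<le> f (hd xs) + (length xs - 1)"
    if "xs \<noteq> []" "successively (\<lambda>x y. {x, y} \<in> H) xs" for xs
    using that
  proof (induction xs rule: induct_list012)
    case (3 x y zs)
    then show ?case using lip[of x y] by auto
  qed auto
  from this[of xs] have "f (j + 2 * N) \<le> f (i + 2 * N) + 5"
    using xs by (auto simp: walks_def)
  moreover have "f (j + 2 * N) = 6" "f (i + 2 * N) = 0"
    using b by (auto simp: f_def mem dest: I)
  ultimately show False by simp
qed

section \<open>Guessing the messages across a cut\<close>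

text \<open>Pairs are oriented, sender first: only messages entering \<open>C\<close> influence the
  states inside.\<close>

definition cut_edges :: "nat set set \<Rightarrow> nat set \<Rightarrow> (nat \<times> nat) set" where
  "cut_edges E C = {(u, v). v \<in> C \<and> u \<in> neighbors E v - C}"

definition cut_guesses :: "nat set set \<Rightarrow> nat set \<Rightarrow> nat \<Rightarrow> (nat \<times> nat \<Rightarrow> bool list) set" where
  "cut_guesses E C b = cut_edges E C \<rightarrow>\<^sub>E {xs. length xs \<le> b}"

definition cut_exchange ::
    "protocol \<Rightarrow> nat set set \<Rightarrow> nat set \<Rightarrow> (nat \<times> nat \<Rightarrow> bool list) \<Rightarrow> (nat \<Rightarrow> view) \<Rightarrow> nat \<Rightarrow> view" where
  "cut_exchange A E C g s v =
     observe (Received (\<lambda>u. if u \<in> neighbors E v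
       then if u \<in> C then message A (s u) v else g (u, v) else [])) (s v)"

text \<open>
  The nodes in \<open>C\<close> on their own, with each message that enters \<open>C\<close> replaced by a uniform guess.
\<close>

primrec guess_run ::
    "protocol \<Rightarrow> nat set set \<Rightarrow> nat set \<Rightarrow> nat \<Rightarrow> nat \<Rightarrow> (nat \<Rightarrow> view) pmf" where
  "guess_run A E C b 0 = toss A C (initial_view E {})"
| "guess_run A E C b (Suc t) = bind_pmf (guess_run A E C b t) (\<lambda>s.
     bind_pmf (pmf_of_set (cut_guesses E C b)) (\<lambda>g. toss A C (cut_exchange A E C g s)))"

lemma card_bool_lists_le:
  "finite {xs::bool list. length xs \<le> b}" "card {xs::bool list. length xs \<le> b} \<le> 2 ^ (b + 1)"
proof -
  have eq: "{xs::bool list. length xs \<le> b} = {xs. set xs \<subseteq> UNIV \<and> length xs \<le> b}" by simp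
  show "finite {xs::bool list. length xs \<le> b}"
    unfolding eq by (rule finite_lists_length_le) simp
  have "card {xs::bool list. length xs \<le> b} = (\<Sum>i\<le>b. 2 ^ i)"
    unfolding eq by (subst card_lists_length_le) simp_all
  also have "\<dots> \<le> 2 ^ (b + 1)"
    by (induction b) auto
  finally show "card {xs::bool list. length xs \<le> b} \<le> 2 ^ (b + 1)" .
qed

lemma cut_guesses:
  assumes "finite (cut_edges E C)"
  shows "finite (cut_guesses E C b)" "cut_guesses E C b \<noteq> {}"
    and "card (cut_guesses E C b) \<le> 2 ^ ((b + 1) * card (cut_edges E C))"
proof -
  show "finite (cut_guesses E C b)"
    unfolding cut_guesses_def using assms card_bool_lists_le(1) by (intro finite_PiE) auto
  show "cut_guesses E C b \<noteq> {}"
    unfolding cut_guesses_def by (auto simp: PiE_eq_empty_iff intro: exI[of _ "[]"])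
  have "card (cut_guesses E C b) = card {xs::bool list. length xs \<le> b} ^ card (cut_edges E C)"
    unfolding cut_guesses_def using assms by (simp add: card_PiE)
  also have "\<dots> \<le> (2 ^ (b + 1)) ^ card (cut_edges E C)"
    by (rule power_mono[OF card_bool_lists_le(2)]) simp
  finally show "card (cut_guesses E C b) \<le> 2 ^ ((b + 1) * card (cut_edges E C))"
    by (simp only: power_mult)
qed

lemma restrict_toss:
  assumes "finite V" "C \<subseteq> V" "\<And>v. v \<in> C \<Longrightarrow> \<sigma> v = \<tau> v"
  shows "map_pmf (\<lambda>\<sigma>. restrict \<sigma> C) (toss A V \<sigma>) = toss A C \<tau>"
proof -
  have "toss A C \<tau> = toss A C \<sigma>"
    unfolding toss_def using assms(3) by (intro Pi_pmf_cong) auto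
  then show ?thesis
    \<comment> \<open>\<open>restrict\<close> and \<open>toss\<close> share the default
      \<open>undefined\<close>, so restricting is exactly the projection of the product
      distribution.\<close>
    unfolding toss_def restrict_def by (simp only: Pi_pmf_subset[OF assms(1,2)])
qed

text \<open>Inside \<open>C\<close> a true round is a guessed round whose guess happens to be
  right.\<close>

lemma exchange_eq_cut_exchange:
  assumes "v \<in> C"
  shows "exchange A E \<sigma> v =
    cut_exchange A E C (restrict (\<lambda>(u, v). message A (\<sigma> u) v) (cut_edges E C)) (restrict \<sigma> C) v"
  unfolding exchange_def cut_exchange_def
  using assms by (intro arg_cong2[of _ _ _ _ observe] arg_cong[of _ _ Received] ext)
    (auto simp: cut_edges_def)

text \<open>A uniform guess is right with probability \<open>1 / card (cut_guesses E C b)\<close> in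
  each round, so \<open>t\<close> rounds cost the \<open>t\<close>-th power. The bound is stated for
  arbitrary nonnegative \<open>f\<close>, because the induction applies it to the expectation after
  one more round.\<close>

lemma nn_integral_run_le_guess_run:
  fixes f :: "(nat \<Rightarrow> view) \<Rightarrow> ennreal"
  assumes bw: "\<And>s u. length (message A s u) \<le> b"
    and V: "finite V" "C \<subseteq> V" and cut: "finite (cut_edges E C)"
    and P: "\<And>x y. (x, y) \<in> P \<Longrightarrow> x \<notin> C \<and> y \<notin> C"
  shows "(\<integral>\<^sup>+\<sigma>. f (restrict \<sigma> C) \<partial>run A V E P t)
    \<le> of_nat (card (cut_guesses E C b)) ^ t * (\<integral>\<^sup>+s. f s \<partial>guess_run A E C b t)"
proof (induction t arbitrary: f)
  case 0
  \<comment> \<open>Nodes in \<open>C\<close> own no pair, so their initial views are those for the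
    empty pair set. Hence one \<open>guess_run\<close> serves all \<open>P\<close>.\<close>
  have "map_pmf (\<lambda>\<sigma>. restrict \<sigma> C) (toss A V (initial_view E P)) = toss A C (initial_view E {})"
    using P by (intro restrict_toss V) (auto simp: initial_view_def)
  from arg_cong[OF this, of "\<lambda>M. \<integral>\<^sup>+s. f s \<partial>measure_pmf M"]
  show ?case by (simp add: restrict_def)
next
  case (Suc t)
  let ?G = "cut_guesses E C b"
  define h where "h g s = (\<integral>\<^sup>+\<tau>. f \<tau> \<partial>toss A C (cut_exchange A E C g s))" for g s
  have step: "(\<integral>\<^sup>+\<tau>. f (restrict \<tau> C) \<partial>toss A V (exchange A E \<sigma>)) \<le> (\<Sum>g\<in>?G. h g (restrict \<sigma> C))"
    for \<sigma>
  proof -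
    define g where "g = restrict (\<lambda>(u, v). message A (\<sigma> u) v) (cut_edges E C)"
    have "g \<in> ?G" using bw by (auto simp: g_def cut_guesses_def)
    have "map_pmf (\<lambda>\<tau>. restrict \<tau> C) (toss A V (exchange A E \<sigma>))
        = toss A C (cut_exchange A E C g (restrict \<sigma> C))"
      unfolding g_def by (intro restrict_toss V exchange_eq_cut_exchange)
    from arg_cong[OF this, of "\<lambda>M. \<integral>\<^sup>+s. f s \<partial>measure_pmf M"]
    have "(\<integral>\<^sup>+\<tau>. f (restrict \<tau> C) \<partial>toss A V (exchange A E \<sigma>)) = h g (restrict \<sigma> C)"
      by (simp add: h_def)
    \<comment> \<open>The right guess depends on states outside \<open>C\<close>; summing over all
      guesses removes this dependence.\<close>
    also have "\<dots> \<le> (\<Sum>g\<in>?G. h g (restrict \<sigma> C))"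
      using \<open>g \<in> ?G\<close> cut_guesses(1)[OF cut] by (intro member_le_sum) auto
    finally show ?thesis .
  qed
  have "(\<integral>\<^sup>+\<sigma>. f (restrict \<sigma> C) \<partial>run A V E P (Suc t))
      = (\<integral>\<^sup>+\<sigma>. \<integral>\<^sup>+\<tau>. f (restrict \<tau> C) \<partial>toss A V (exchange A E \<sigma>) \<partial>run A V E P t)"
    by simp
  also have "\<dots> \<le> (\<integral>\<^sup>+\<sigma>. (\<Sum>g\<in>?G. h g (restrict \<sigma> C)) \<partial>run A V E P t)"
    by (intro nn_integral_mono step)
  also have "\<dots> \<le> of_nat (card ?G) ^ t * (\<integral>\<^sup>+s. (\<Sum>g\<in>?G. h g s) \<partial>guess_run A E C b t)"
    by (rule Suc.IH)
  also have "(\<lambda>s. \<Sum>g\<in>?G. h g s) = (\<lambda>s. of_nat (card ?G) * (\<integral>\<^sup>+g. h g s \<partial>pmf_of_set ?G))"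
  proof
    fix s
    have "of_nat (card ?G) \<noteq> (0::ennreal)" using cut_guesses[OF cut] by simp
    then show "(\<Sum>g\<in>?G. h g s) = of_nat (card ?G) * (\<integral>\<^sup>+g. h g s \<partial>pmf_of_set ?G)"
      by (simp add: nn_integral_pmf_of_set cut_guesses[OF cut] ennreal_times_divide
        mult.commute[of _ "sum _ _"] ennreal_mult_divide_eq)
  qed
  also have "(\<integral>\<^sup>+s. of_nat (card ?G) * (\<integral>\<^sup>+g. h g s \<partial>pmf_of_set ?G) \<partial>guess_run A E C b t)
      = of_nat (card ?G) * (\<integral>\<^sup>+s. f s \<partial>guess_run A E C b (Suc t))"
    by (simp add: nn_integral_cmult h_def)
  finally show ?case by (simp add: mult.assoc mult.left_commute)
qed

text \<open>The quotient of the binomials is a product of \<open>p\<close> factors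
  \<open>(r - i) / (m - i)\<close>, each at most 1/2 as long as \<open>i < r\<close>.\<close>

lemma binomial_half_le:
  fixes r m p :: nat
  assumes "2 * r \<le> m"
  shows "2 ^ p * (r choose p) \<le> m choose p"
proof (induction p)
  case (Suc p)
  have "Suc p * (2 ^ Suc p * (r choose Suc p)) = 2 ^ Suc p * ((r - p) * (r choose p))"
    using binomial_absorb_comp[of r p] binomial_absorption[of p r]
    by (metis mult.left_commute)
  also have "\<dots> = 2 * (r - p) * (2 ^ p * (r choose p))" by simp
  also have "\<dots> \<le> (m - p) * (m choose p)"
    using assms Suc.IH by (intro mult_le_mono) auto
  also have "\<dots> = Suc p * (m choose Suc p)"
    using binomial_absorb_comp[of m p] binomial_absorption[of p m] by metis
  finally show ?case by (simp only: mult_le_cancel1)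
qed simp

text \<open>Average over all \<open>p\<close>-subsets \<open>S\<close> of \<open>I\<close>. Each
  success probability is at most \<open>2 ^ X\<close> times that of the common
  \<open>guess_run\<close>, and a single output there covers at most a fraction
  \<open>1 / 2 ^ p\<close> of the sets \<open>S\<close>. Hence
  \<open>2 / 3 \<le> 2 ^ X / 2 ^ p\<close>.\<close>

lemma cut_communication_bound:
  fixes P :: "'i set \<Rightarrow> (nat \<times> nat) set" and R :: "(nat \<Rightarrow> view) \<Rightarrow> 'i set"
  assumes bw: "\<And>s u. length (message A s u) \<le> b"
    and V: "finite V" "C \<subseteq> V" and cut: "finite (cut_edges E C)"
    and I: "finite I" "p \<le> card I"
    and P: "\<And>S x y. S \<subseteq> I \<Longrightarrow> (x, y) \<in> P S \<Longrightarrow> x \<notin> C \<and> y \<notin> C"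
    and prob: "\<And>S. S \<subseteq> I \<Longrightarrow> card S = p \<Longrightarrow> measure_pmf.prob (run A V E (P S) T)
      {\<sigma>. S \<subseteq> R (restrict \<sigma> C) \<and> R (restrict \<sigma> C) \<subseteq> I \<and> 2 * card (R (restrict \<sigma> C)) \<le> card I} \<ge> 2 / 3"
  shows "p \<le> (b + 1) * card (cut_edges E C) * T"
proof -
  let ?SS = "{S. S \<subseteq> I \<and> card S = p}"
  let ?M = "guess_run A E C b T"
  define good where "good S s \<longleftrightarrow> S \<subseteq> R s \<and> R s \<subseteq> I \<and> 2 * card (R s) \<le> card I" for S s
  \<comment> \<open>\<open>2 ^ X\<close> bounds the number of transcripts: there are at most
    \<open>2 ^ (b + 1)\<close> strings per message, on each cut edge in each of \<open>T\<close>
    rounds.\<close>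
  define X where "X = (b + 1) * card (cut_edges E C) * T"
  have fin: "finite ?SS" using I(1) by simp
  have card: "card ?SS = card I choose p" using n_subsets[OF I(1)] .
  have pos: "card I choose p > 0" using I(2) by simp
  have M: "of_nat (card (cut_guesses E C b)) ^ T \<le> (of_nat (2 ^ X) :: ennreal)"
  proof -
    have "card (cut_guesses E C b) ^ T \<le> (2 ^ ((b + 1) * card (cut_edges E C))) ^ T"
      by (rule power_mono[OF cut_guesses(3)[OF cut]]) simp
    then have "card (cut_guesses E C b) ^ T \<le> 2 ^ X" by (simp only: X_def power_mult)
    then show ?thesis by (metis of_nat_mono of_nat_power)
  qed
  have few: "2 ^ p * card {S \<in> ?SS. good S s} \<le> card I choose p" for s
  proof (cases "R s \<subseteq> I \<and> 2 * card (R s) \<le> card I")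
    case True
    have fR: "finite (R s)" using True I(1) finite_subset by blast
    have "card {S \<in> ?SS. good S s} \<le> card {S. S \<subseteq> R s \<and> card S = p}"
      using fR by (intro card_mono) (auto simp: good_def)
    also have "\<dots> = card (R s) choose p" using n_subsets[OF fR] .
    finally have "2 ^ p * card {S \<in> ?SS. good S s} \<le> 2 ^ p * (card (R s) choose p)" by simp
    also have "\<dots> \<le> card I choose p" using True by (intro binomial_half_le) auto
    finally show ?thesis .
  next
    case False
    then have "{S \<in> ?SS. good S s} = {}" by (auto simp: good_def)
    then show ?thesis by (metis card.empty mult_0_right zero_le)
  qed
  have "ennreal (2 / 3) \<le> of_nat (2 ^ X) * (\<integral>\<^sup>+s. indicator {s. good S s} s \<partial>?M)"
    if "S \<in> ?SS" for S
  proof -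
    have "ennreal (2 / 3) \<le> emeasure (run A V E (P S) T) {\<sigma>. good S (restrict \<sigma> C)}"
      using prob[of S] that unfolding good_def
      by (simp add: measure_pmf.emeasure_eq_measure)
    also have "\<dots> = (\<integral>\<^sup>+\<sigma>. indicator {\<sigma>. good S (restrict \<sigma> C)} \<sigma> \<partial>run A V E (P S) T)"
      by simp
    also have "\<dots> = (\<integral>\<^sup>+\<sigma>. indicator {s. good S s} (restrict \<sigma> C) \<partial>run A V E (P S) T)"
      by (intro nn_integral_cong) (simp add: indicator_def)
    also have "\<dots> \<le> of_nat (card (cut_guesses E C b)) ^ T * (\<integral>\<^sup>+s. indicator {s. good S s} s \<partial>?M)"
      using P that by (intro nn_integral_run_le_guess_run bw V cut) auto
    also have "\<dots> \<le> of_nat (2 ^ X) * (\<integral>\<^sup>+s. indicator {s. good S s} s \<partial>?M)"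
      using M by (intro mult_right_mono) auto
    finally show ?thesis .
  qed
  then have "(\<Sum>S\<in>?SS. ennreal (2 / 3))
      \<le> (\<Sum>S\<in>?SS. of_nat (2 ^ X) * (\<integral>\<^sup>+s. indicator {s. good S s} s \<partial>?M))"
    by (intro sum_mono)
  also have "\<dots> = of_nat (2 ^ X) * (\<integral>\<^sup>+s. (\<Sum>S\<in>?SS. indicator {s. good S s} s) \<partial>?M)"
    by (simp add: sum_distrib_left nn_integral_sum)
  also have "(\<integral>\<^sup>+s. (\<Sum>S\<in>?SS. indicator {s. good S s} s) \<partial>?M)
      \<le> (\<integral>\<^sup>+s. ennreal (real (card I choose p) / 2 ^ p) \<partial>?M)"
  proof (rule nn_integral_mono)
    fix s
    have "(\<Sum>S\<in>?SS. indicator {s. good S s} s) = (of_nat (card {S \<in> ?SS. good S s}) :: ennreal)"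
      using fin by (simp add: indicator_def sum.If_cases Int_def)
    also have "\<dots> = ennreal (real (card {S \<in> ?SS. good S s}))" 
      by (simp add: ennreal_of_nat_eq_real_of_nat)
    also have "\<dots> \<le> ennreal (real (card I choose p) / 2 ^ p)"
    proof (rule ennreal_leI)
      have "real (2 ^ p * card {S \<in> ?SS. good S s}) \<le> real (card I choose p)"
        using few[of s] by (rule of_nat_mono)
      then show "real (card {S \<in> ?SS. good S s}) \<le> real (card I choose p) / 2 ^ p"
        by (simp add: field_simps)
    qed
    finally show "(\<Sum>S\<in>?SS. indicator {s. good S s} s) \<le> ennreal (real (card I choose p) / 2 ^ p)" .
  qed
  finally have "of_nat (card I choose p) * ennreal (2 / 3)
      \<le> of_nat (2 ^ X) * ennreal (real (card I choose p) / 2 ^ p)"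
    by (simp add: card mult_left_mono)
  also have "of_nat (card I choose p) * ennreal (2 / 3) = ennreal (real (card I choose p) * (2 / 3))"
    unfolding ennreal_of_nat_eq_real_of_nat by (rule ennreal_mult[symmetric]) simp_all
  also have "of_nat (2 ^ X) * ennreal (real (card I choose p) / 2 ^ p)
      = ennreal (real (2 ^ X) * (real (card I choose p) / 2 ^ p))"
    unfolding ennreal_of_nat_eq_real_of_nat by (rule ennreal_mult[symmetric]) simp_all
  finally have "real (card I choose p) * (2 / 3) \<le> real (2 ^ X) * (real (card I choose p) / 2 ^ p)"
    by (rule ennreal_le_iff[THEN iffD1, rotated]) simp
  then have le: "2 / 3 * (2::real) ^ p \<le> 2 ^ X"
    using pos by (simp add: field_simps)
  \<comment> \<open>By integrality, \<open>p > X\<close> would make \<open>2 ^ p / 2 ^ X\<close> at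
    least 2, whereas \<open>le\<close> allows only 3/2.\<close>
  show ?thesis
  proof (rule ccontr)
    assume "\<not> ?thesis"
    then have "X + 1 \<le> p" by (simp add: X_def)
    then have "(2::real) ^ (X + 1) \<le> 2 ^ p" by (intro power_increasing) auto
    then have "2 * (2::real) ^ X \<le> 2 ^ p" by simp
    moreover have "(2::real) ^ X > 0" by simp
    ultimately show False using le by linarith
  qed
qed

section \<open>The lower bound\<close>

definition hard_pairs :: "nat \<Rightarrow> (nat \<times> nat) set \<Rightarrow> (nat \<times> nat) set" where
  "hard_pairs N S = (\<lambda>(i, j). (i + 2 * N, j + 2 * N)) ` S"

text \<open>The complement of the pendants, that is, the nodes that initially know nothing of the
  pairs.\<close>

definition core :: "nat \<Rightarrow> nat \<Rightarrow> nat set" where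
  "core N n = {..<2 * N} \<union> {4 * N..<n}"

lemma cut_edges_core:
  assumes "6 * N < n" "\<And>i j. (i, j) \<in> I \<Longrightarrow> i < N \<and> N \<le> j \<and> j < 2 * N"
  shows "cut_edges (hard_edges N I n) (core N n) \<subseteq> (\<lambda>i. (i + 2 * N, i)) ` {..<2 * N}"
  using assms(1)
  by (auto simp: cut_edges_def core_def neighbors_def doubleton_mem_hard_edges_iff hard_adj_def
      dest: assms(2))

lemma hard_instance_bound:
  fixes m :: real
  assumes q: "prime q" "6 * q ^ 2 < n" and m: "2 * m \<le> real (q ^ 3)" and p: "p \<le> q ^ 3"
    and K: "K \<ge> 1" and bw: "\<And>s u. length (message A s u) \<le> b"
    and sol: "solves_in A T (2 / 3) m (inputs_diameter_le 6 K n p)"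
  shows "p \<le> (b + 1) * (2 * q ^ 2) * T"
proof -
  define N where "N = q ^ 2"
  define I where "I = incidences q"
  define E where "E = hard_edges N I n"
  define C where "C = core N n"
  \<comment> \<open>The output is read off at the points only. They lie in \<open>C\<close>, so
    \<open>R\<close> survives the restriction of the states to \<open>C\<close>.\<close>
  define R where "R s = {(i, j) \<in> I. j \<in> result A (s i)}" for s :: "nat \<Rightarrow> view"
  have bI: "i < N \<and> N \<le> j \<and> j < 2 * N" if "(i, j) \<in> I" for i j
    using incidences_bounds[of i j q] that by (simp add: I_def N_def)
  have sq: "i = i' \<or> j = j'" if "(i, j) \<in> I" "(i, j') \<in> I" "(i', j) \<in> I" "(i', j') \<in> I" for i j i' j'
    using incidences_no_square[OF q(1)] that unfolding I_def by blast
  have n: "6 * N < n" using q by (simp add: N_def)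
  have fI: "finite I" and cI: "card I = q ^ 3"
    by (simp_all add: I_def finite_incidences card_incidences)
  have cut: "cut_edges E C \<subseteq> (\<lambda>i. (i + 2 * N, i)) ` {..<2 * N}"
    unfolding E_def C_def by (rule cut_edges_core[OF n bI])
  have graph: "simple_graph {..<n} E"
    unfolding E_def by (rule simple_graph_hard_edges[OF n bI])
  have fE: "finite E"
  proof (rule finite_subset)
    show "E \<subseteq> Pow {..<n}" using graph by (auto simp: simple_graph_def)
  qed simp
  have "p \<le> (b + 1) * card (cut_edges E C) * T"
  proof (rule cut_communication_bound[OF bw, where V = "{..<n}" and I = I and P = "hard_pairs N" and R = R])
    show "C \<subseteq> {..<n}" using n by (auto simp: C_def core_def)
    show "finite (cut_edges E C)" using cut finite_subset by blast
    show "p \<le> card I" using p cI by simp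
    show "x \<notin> C \<and> y \<notin> C" if "S \<subseteq> I" "(x, y) \<in> hard_pairs N S" for S x y
      using that bI by (fastforce simp: hard_pairs_def C_def core_def)
  next
    fix S assume S: "S \<subseteq> I" "card S = p"
    have "card (hard_pairs N S) = p"
      unfolding hard_pairs_def using S by (subst card_image) (auto simp: inj_on_def)
    moreover have "hard_pairs N S \<subseteq> {..<n} \<times> {..<n}"
      using S(1) bI n by (fastforce simp: hard_pairs_def)
    moreover have "n \<le> n ^ K" using K n by (intro self_le_power) auto
    then have "{..<n} \<subseteq> {..<n ^ K}" by auto
    ultimately have "({..<n}, E, hard_pairs N S) \<in> inputs_diameter_le 6 K n p"
      using graph diameter_hard_edges[OF n] by (simp add: inputs_diameter_le_def inputs_def E_def)
    then have "2 / 3 \<le> measure_pmf.prob (run A {..<n} E (hard_pairs N S) T)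
        {\<sigma>. correct_output m {..<n} E (hard_pairs N S) (\<lambda>v. result A (\<sigma> v))}"
      using sol by (auto simp: solves_in_def)
    also have "\<dots> \<le> measure_pmf.prob (run A {..<n} E (hard_pairs N S) T)
        {\<sigma>. S \<subseteq> R (restrict \<sigma> C) \<and> R (restrict \<sigma> C) \<subseteq> I \<and> 2 * card (R (restrict \<sigma> C)) \<le> card I}"
    proof (intro measure_pmf.finite_measure_mono subsetI CollectI)
      fix \<sigma> assume "\<sigma> \<in> {\<sigma>. correct_output m {..<n} E (hard_pairs N S) (\<lambda>v. result A (\<sigma> v))}"
      then obtain H where H: "plus2_pairwise_spanner E (hard_pairs N S) H" "real (card H) \<le> m"
          "\<And>v. v < n \<Longrightarrow> result A (\<sigma> v) = neighbors H v"
        by (auto simp: correct_output_def)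
      have fH: "finite H" using H(1) fE finite_subset by (auto simp: plus2_pairwise_spanner_def)
      have R: "R (restrict \<sigma> C) = {(i, j) \<in> I. {i, j} \<in> H}"
        unfolding R_def using bI n H(3)
        by (fastforce simp: C_def core_def neighbors_def insert_commute)
      have "{i, j} \<in> H" if "(i, j) \<in> S" for i j
      proof (rule spanner_contains_incidence[OF bI sq _ H(1)[unfolded E_def]])
        show "(i, j) \<in> I" using that S by blast
        show "(i + 2 * N, j + 2 * N) \<in> hard_pairs N S" using that by (force simp: hard_pairs_def)
      qed
      then have "S \<subseteq> R (restrict \<sigma> C)" using S(1) by (auto simp: R)
      moreover have "R (restrict \<sigma> C) \<subseteq> I" by (auto simp: R)
      moreover have "2 * card (R (restrict \<sigma> C)) \<le> card I"
      proof -
        \<comment> \<open>Points and lines have disjoint numbers, so incidences are counted by edges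
          of \<open>H\<close>, of which there are at most half of \<open>q ^ 3\<close>.\<close>
        have "inj_on (\<lambda>(i, j). {i, j}) I"
        proof (rule inj_onI, clarify)
          fix i j i' j' assume "(i, j) \<in> I" "(i', j') \<in> I" "{i, j} = {i', j'}"
          then show "i = i' \<and> j = j'" using bI[of i j] bI[of i' j'] by (auto simp: doubleton_eq_iff)
        qed
        then have "card (R (restrict \<sigma> C)) \<le> card H"
          by (intro card_inj_on_le[of "\<lambda>(i, j). {i, j}"] fH) (auto simp: R intro: inj_on_subset)
        then have "2 * real (card (R (restrict \<sigma> C))) \<le> real (q ^ 3)" using H(2) m by linarith
        then show ?thesis unfolding cI by linarith
      qed
      ultimately show "S \<subseteq> R (restrict \<sigma> C) \<and> R (restrict \<sigma> C) \<subseteq> I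
        \<and> 2 * card (R (restrict \<sigma> C)) \<le> card I" by blast
    qed simp
    finally show "2 / 3 \<le> measure_pmf.prob (run A {..<n} E (hard_pairs N S) T)
        {\<sigma>. S \<subseteq> R (restrict \<sigma> C) \<and> R (restrict \<sigma> C) \<subseteq> I \<and> 2 * card (R (restrict \<sigma> C)) \<le> card I}" .
  qed (use fI in auto)
  moreover have "card (cut_edges E C) \<le> 2 * N"
    using surj_card_le[OF _ cut] by simp
  ultimately show ?thesis
    unfolding N_def by (meson le_trans mult_le_mono order_refl)
qed

section \<open>Choice of the constants\<close>

lemma powr_three_halves_le:
  fixes n q :: nat
  assumes "n \<le> 400 * q ^ 2"
  shows "real n powr (3 / 2) \<le> 8000 * real q ^ 3"
proof -
  have "real n powr (3 / 2) \<le> (real (20 * q) powr 2) powr (3 / 2)"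
  proof (rule powr_mono2)
    have "real n \<le> real (400 * q ^ 2)" using assms by (rule of_nat_mono)
    then show "real n \<le> real (20 * q) powr 2"
      by (cases "q = 0") (simp_all add: powr_realpow power_mult_distrib)
  qed simp_all
  also have "\<dots> = real (20 * q) powr 3" unfolding powr_powr by simp
  also have "\<dots> = 8000 * real q ^ 3"
    by (cases "q = 0") (simp_all add: powr_realpow power_mult_distrib)
  finally show ?thesis .
qed

theorem theorem23:
  "\<exists>c::real. c > 0 \<and> (\<exists>D::nat.
     \<forall>(B::real) (K::nat). B > 0 \<longrightarrow> K \<ge> 1 \<longrightarrow>
       (\<exists>\<kappa>::real. \<kappa> > 0 \<and> (\<exists>n0::nat. \<forall>n\<ge>n0. \<forall>p::nat. real p \<le> c * real n powr (3/2) \<longrightarrow>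
          (\<forall>A T. bandwidth_le A (B * log 2 (real n)) \<longrightarrow>
             (solves_in A T (2/3) (c * real n powr (3/2)) (inputs K n p) \<longrightarrow>
                real T \<ge> \<kappa> * (real p / (real n * log 2 (real n)))) \<and>
             (solves_in A T (2/3) (c * real n powr (3/2)) (inputs_diameter_le D K n p) \<longrightarrow>
                real T \<ge> \<kappa> * (real p / (real n * log 2 (real n))))))))"
proof -
  \<comment> \<open>From \<open>n \<le> (20 * q) ^ 2\<close> follows
    \<open>n powr (3 / 2) \<le> 8000 * q ^ 3\<close>. Half of 1/8000 keeps the spanner to half of
    the incidences, and \<open>p\<close> below their number.\<close>
  define c :: real where "c = 1 / 16000"
  obtain n1 :: nat where n1: "\<And>n. n \<ge> n1 \<Longrightarrow> \<exists>q::nat. prime q \<and> 6 * q ^ 2 < n \<and> n \<le> 400 * q ^ 2"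
    using eventually_prime_square by (auto simp: eventually_sequentially)
  have bound: "real T \<ge> 1 / (B + 1) * (real p / (real n * log 2 (real n)))"
    if B: "B > 0" and K: "K \<ge> 1" and n: "n \<ge> max 2 n1" and p: "real p \<le> c * real n powr (3/2)"
      and bw: "bandwidth_le A (B * log 2 (real n))"
      and sol: "solves_in A T (2/3) (c * real n powr (3/2)) (inputs_diameter_le 6 K n p)"
    for B :: real and K n p A T
  proof -
    define L where "L = log 2 (real n)"
    have L: "L \<ge> 1" using n by (simp add: L_def le_log_iff)
    obtain q where q: "prime q" "6 * q ^ 2 < n" "n \<le> 400 * q ^ 2" using n1[of n] n by auto
    have m: "2 * (c * real n powr (3/2)) \<le> real (q ^ 3)"
      using powr_three_halves_le[OF q(3)] by (simp add: c_def)
    have "real p \<le> real (q ^ 3)" using p m by linarith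
    then have pq: "p \<le> q ^ 3" by (simp only: of_nat_le_iff)
    define b where "b = nat \<lfloor>B * L\<rfloor>"
    have len: "length (message A s u) \<le> b" for s u
      using bw unfolding bandwidth_le_def b_def L_def by (simp add: le_nat_floor)
    have "p \<le> (b + 1) * (2 * q ^ 2) * T"
      by (rule hard_instance_bound[OF q(1,2) m pq K len sol])
    also have "\<dots> \<le> (b + 1) * n * T" using q(2) by (intro mult_le_mono) auto
    finally have "real p \<le> real ((b + 1) * n * T)" by (rule of_nat_mono)
    also have "\<dots> = (real b + 1) * (real n * real T)" by (simp add: algebra_simps)
    \<comment> \<open>Since \<open>L \<ge> 1\<close>, the extra 1 in \<open>b + 1\<close> is
      absorbed into \<open>(B + 1) * L\<close>; this yields the factor
      \<open>1 / (B + 1)\<close>.\<close>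
    also have "\<dots> \<le> ((B + 1) * L) * (real n * real T)"
    proof (rule mult_right_mono)
      have "real b \<le> B * L" using B L by (simp add: b_def)
      then show "real b + 1 \<le> (B + 1) * L" using L by (simp add: algebra_simps)
    qed simp
    finally have "real p \<le> real T * ((B + 1) * (real n * L))" by (simp add: mult_ac)
    moreover have "(B + 1) * (real n * L) > 0" using B L n by simp
    ultimately have "real p / ((B + 1) * (real n * L)) \<le> real T" by (simp only: pos_divide_le_eq)
    then show ?thesis by (simp add: L_def)
  qed
  \<comment> \<open>A protocol for all inputs also solves those of small diameter, so one bound
    gives both claims.\<close>
  have mono: "solves_in A T r m (inputs_diameter_le 6 K n p)" if "solves_in A T r m (inputs K n p)"
    for A T r m K n p
    using that by (auto simp: solves_in_def inputs_diameter_le_def)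
  show ?thesis
  proof (rule exI[of _ c], (rule conjI[OF _ exI[of _ 6]]; (intro allI impI)?))
    show "c > 0" by (simp add: c_def)
    fix B :: real and K :: nat assume "B > 0" "K \<ge> 1"
    then show "\<exists>\<kappa>>0. \<exists>n0. \<forall>n\<ge>n0. \<forall>p. real p \<le> c * real n powr (3/2) \<longrightarrow>
        (\<forall>A T. bandwidth_le A (B * log 2 (real n)) \<longrightarrow>
          (solves_in A T (2/3) (c * real n powr (3/2)) (inputs K n p) \<longrightarrow>
            \<kappa> * (real p / (real n * log 2 (real n))) \<le> real T) \<and>
          (solves_in A T (2/3) (c * real n powr (3/2)) (inputs_diameter_le 6 K n p) \<longrightarrow>
            \<kappa> * (real p / (real n * log 2 (real n))) \<le> real T))"
    proof (intro exI[of _ "1 / (B + 1)"] exI[of _ "max 2 n1"] conjI allI impI)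
      show "1 / (B + 1) > 0" using \<open>B > 0\<close> by simp
    qed (assumption | rule bound | rule mono)+
  qed
qed

end
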